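(* Let $d\ge 1$ and let $w$ be an infinite $d$-ary word. Let $\Delta_w$ denote the maximal degree of irrationality of the letters in $w$. Then, for every integer $n\geq 1$, $$p_w(n)\geq (\Delta_w-1)(n-1)+d.$$
   Context: An infinite $d$-ary word is a sequence $w\in\{1,\ldots,d\}^{\mathbb{N}}$ in which all $d$ letters actually occur. A factor of length $n$ of $w$ is a finite word of length $n$ that occurs in $w$ as a block of $n$ consecutive letters. $p_w(n)$ is the number of distinct factors of length $n$ of $w$ (in particular $p_w(0)=1$ and $p_w(1)=d$). For $n\geq 1$, $\mathrm{pref}_n(w)$ is the prefix of $w$ of length $n$, and $|u|_i$ is the number of occurrences of the letter $i$ in the finite word $u$. The letter frequencies of $w$ are not assumed to exist. Let $F_w\subseteq[0,1]^d$ be the set of all subsequential limits of the sequence $\left(\frac1n(|\mathrm{pref}_n(w)|_1,\ldots,|\mathrm{pref}_n(w)|_d)\right)_{n\ge 1}$, i.e. the set of $(f_1,\ldots,f_d)\in[0,1]^d$ for which there is an increasing sequence of integers $(n_l)_l$ with $|\mathrm{pref}_{n_l}(w)|_i/n_l\to f_i$ as $l\to\infty$ for every $i\in\{1,\ldots,d\}$. The maximal degree of irrationality of the letters in $w$ is $$\Delta_w:=\max\{\dim_{\mathbb{Q}}\mathrm{Span}_{\mathbb{Q}}(f_1,\ldots,f_d) : (f_1,\ldots,f_d)\in F_w\},$$ where $\mathrm{Span}_{\mathbb{Q}}(f_1,\ldots,f_d)\subseteq\mathbb{R}$ is the $\mathbb{Q}$-linear subspace of $\mathbb{R}$ generated by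 the real numbers $f_1,\ldots,f_d$. *)

theory Defs
  imports Complex_Main "HOL-Library.FuncSet"
begin

text \<open>An infinite word is a sequence indexed from 0; the letters are the numbers 1, ..., d.\<close>

definition d_ary_word :: "nat \<Rightarrow> (nat \<Rightarrow> nat) \<Rightarrow> bool" where
  "d_ary_word d w \<longleftrightarrow> range w = {1..d}"

definition factors :: "(nat \<Rightarrow> 'a) \<Rightarrow> nat \<Rightarrow> 'a list set" where
  "factors w n = {map w [i..<i + n] | i. True}"

definition complexity :: "(nat \<Rightarrow> 'a) \<Rightarrow> nat \<Rightarrow> nat" where
  "complexity w n = card (factors w n)"

definition pref :: "nat \<Rightarrow> (nat \<Rightarrow> 'a) \<Rightarrow> 'a list" where
  "pref n w = map w [0..<n]"

text \<open>Vectors in \<open>[0,1]\<^sup>d\<close> are functions on \<open>{1..d}\<close>, extended by \<open>undefined\<close> elsewhere.\<close>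

definition freq_limits :: "nat \<Rightarrow> (nat \<Rightarrow> nat) \<Rightarrow> (nat \<Rightarrow> real) set" where
  "freq_limits d w =
     {f \<in> {1..d} \<rightarrow>\<^sub>E {0..1}.
        \<exists>r :: nat \<Rightarrow> nat. strict_mono r \<and> (\<forall>l. r l \<ge> 1) \<and>
          (\<forall>i\<in>{1..d}. (\<lambda>l. real (count_list (pref (r l) w) i) / real (r l)) \<longlonglongrightarrow> f i)}"

definition rat_scale :: "rat \<Rightarrow> real \<Rightarrow> real" where
  "rat_scale q x = of_rat q * x"

global_interpretation rat_real: vector_space rat_scale
  by unfold_locales (simp_all add: rat_scale_def algebra_simps of_rat_add of_rat_mult)

definition max_irrationality :: "nat \<Rightarrow> (nat \<Rightarrow> nat) \<Rightarrow> nat" where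
  "max_irrationality d w =
     Max {rat_real.dim (rat_real.span (f ` {1..d})) | f. f \<in> freq_limits d w}"

end

theory Submission
  imports Defs
begin

text \<open>
  The \<open>i\<close>-th factor of length \<open>n + 1\<close> is an edge of the Rauzy graph, from the \<open>i\<close>-th to the
  \<open>(i + 1)\<close>-st factor of length \<open>n\<close>, so the word is a walk through all vertices and edges. Along a
  subsequence realising a vector of letter frequencies one may assume that the edge frequencies also
  converge; the limits satisfy Kirchhoff's law at each vertex. The graph being connected, the flow is
  determined rationally by its values off a spanning tree, that is, by \<open>p(n+1) - p(n) + 1\<close> numbers.
  Letter frequencies are sums of edge frequencies, whence \<open>\<Delta> \<le> p(n+1) - p(n) + 1\<close>.
\<close>

section \<open>Empirical frequencies and their limits\<close>

definition freq :: "(nat \<Rightarrow> 'a) \<Rightarrow> nat \<Rightarrow> 'a \<Rightarrow> real" where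
  "freq g N a = real (card {k. k < N \<and> g k = a}) / real N"

lemma freq_bounds: "0 \<le> freq g N a" "freq g N a \<le> 1"
proof -
  have "card {k. k < N \<and> g k = a} \<le> card {..<N}"
    by (rule card_mono) auto
  then show "freq g N a \<le> 1"
    by (cases "N = 0") (auto simp: freq_def divide_simps)
qed (simp add: freq_def)

text \<open>The fibres of \<open>g\<close> over the values that \<open>h\<close> sends to
  \<open>b\<close> are disjoint. With \<open>h\<close> a source, target or letter map this reduces
  everything to edge frequencies.\<close>

lemma freq_comp:
  assumes "finite (range g)"
  shows "freq (\<lambda>k. h (g k)) N b = (\<Sum>a | a \<in> range g \<and> h a = b. freq g N a)"
proof -
  let ?A = "{a. a \<in> range g \<and> h a = b}" and ?C = "\<lambda>a. {k. k < N \<and> g k = a}"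
  have "{k. k < N \<and> h (g k) = b} = \<Union> (?C ` ?A)"
    by auto
  also have "card \<dots> = (\<Sum>a\<in>?A. card (?C a))"
  proof (rule card_UN_disjoint)
    show "finite ?A" using assms by simp
  qed auto
  finally have "card {k. k < N \<and> h (g k) = b} = (\<Sum>a\<in>?A. card (?C a))" .
  then show ?thesis
    by (simp add: freq_def sum_divide_distrib)
qed

text \<open>Shifting the window by one loses position 0 and gains position \<open>N\<close>, so a
  count changes by at most one.\<close>

lemma freq_Suc_diff: "\<bar>freq (\<lambda>k. g (Suc k)) N v - freq g N v\<bar> \<le> 1 / real N"
proof -
  let ?A = "{k. k < N \<and> g (Suc k) = v}" and ?B = "{k. k < N \<and> g k = v}"
  have "Suc ` ?A \<subseteq> insert N ?B"
    by auto
  then have "card (Suc ` ?A) \<le> card (insert N ?B)"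
    by (intro card_mono) auto
  then have 1: "card ?A \<le> card ?B + 1"
    by (simp add: card_image card_insert_if)
  have "?B \<subseteq> insert 0 (Suc ` ?A)"
  proof
    fix k assume "k \<in> ?B"
    then show "k \<in> insert 0 (Suc ` ?A)" by (cases k) auto
  qed
  then have "card ?B \<le> card (insert 0 (Suc ` ?A))"
    by (intro card_mono) auto
  also have "\<dots> \<le> card ?A + 1"
    by (simp add: card_image card_insert_if)
  finally have "\<bar>real (card ?A) - real (card ?B)\<bar> \<le> 1"
    using 1 by linarith
  then have "\<bar>real (card ?A) - real (card ?B)\<bar> / real N \<le> 1 / real N"
    by (rule divide_right_mono) simp
  then show ?thesis
    by (simp add: freq_def diff_divide_distrib[symmetric])
qed

text \<open>Bolzano-Weierstrass in a finite-dimensional cube, by refining the subsequence one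
  coordinate at a time.\<close>

lemma convergent_subseq_family:
  fixes F :: "nat \<Rightarrow> 'a \<Rightarrow> real"
  assumes "finite A" and bnd: "\<And>l a. a \<in> A \<Longrightarrow> F l a \<in> {0..1}"
  shows "\<exists>s m. strict_mono (s :: nat \<Rightarrow> nat) \<and> (\<forall>a\<in>A. (\<lambda>l. F (s l) a) \<longlonglongrightarrow> m a \<and> m a \<in> {0..1})"
  using assms
proof (induction A rule: finite_induct)
  case empty
  show ?case by (intro exI[of _ id]) (simp add: strict_mono_def)
next
  case (insert x A)
  obtain s m where s: "strict_mono (s :: nat \<Rightarrow> nat)"
      "\<And>a. a \<in> A \<Longrightarrow> (\<lambda>l. F (s l) a) \<longlonglongrightarrow> m a \<and> m a \<in> {0..1}"
    using insert by blast
  have x: "0 \<le> F l x" "F l x \<le> 1" for l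
    using insert.prems by auto
  obtain t where t: "strict_mono (t :: nat \<Rightarrow> nat)" "monoseq (\<lambda>l. F (s (t l)) x)"
    using seq_monosub[of "\<lambda>l. F (s l) x"] by blast
  have "Bseq (\<lambda>l. F (s (t l)) x)"
    using x by (intro BseqI'[of _ 1]) auto
  then obtain y where y: "(\<lambda>l. F (s (t l)) x) \<longlonglongrightarrow> y"
    using Bseq_monoseq_convergent t(2) by (auto simp: convergent_def)
  have "y \<in> {0..1}"
    using LIMSEQ_le_const[OF y] LIMSEQ_le_const2[OF y] x by auto
  have "(\<lambda>l. F (s (t l)) a) \<longlonglongrightarrow> m a" if "a \<in> A" for a
    using LIMSEQ_subseq_LIMSEQ[OF conjunct1[OF s(2)[OF that]] t(1)] by (simp add: o_def)
  then show ?case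
    using s t(1) y \<open>y \<in> {0..1}\<close> insert.hyps
    by (intro exI[of _ "s \<circ> t"] exI[of _ "m(x := y)"])
       (auto simp: o_def strict_mono_def)
qed

section \<open>Flows on the graph traced by a walk\<close>

lemma flow_in_span_off_tree:
  fixes e :: "nat \<Rightarrow> 'e" and src tgt :: "'e \<Rightarrow> 'v" and \<mu> :: "'e \<Rightarrow> real"
  assumes fin: "finite (range e)"
    and walk: "\<And>k. tgt (e k) = src (e (Suc k))"
    and flow: "\<And>v. (\<Sum>a | a \<in> range e \<and> tgt a = v. \<mu> a) = (\<Sum>a | a \<in> range e \<and> src a = v. \<mu> a)"
  shows "\<exists>B. finite B \<and> card B + card (range (src \<circ> e)) \<le> card (range e) + 1
             \<and> \<mu> ` range e \<subseteq> rat_real.span B"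
proof -
  define x where "x k = src (e k)" for k
  \<comment> \<open>the steps of the walk that discover a vertex, and the spanning tree formed by their edges\<close>
  define New where "New = {k. x (Suc k) \<notin> x ` {..k}}"
  define T where "T = e ` New"
  define S where "S = rat_real.span (\<mu> ` (range e - T))"
  have tgt: "tgt (e k) = x (Suc k)" for k
    by (simp add: walk x_def)
  have inj_x: "j = k" if "j \<in> New" "k \<in> New" "x (Suc j) = x (Suc k)" for j k
  proof (rule ccontr)
    assume "j \<noteq> k"
    then have "x (Suc j) \<in> x ` {..k} \<or> x (Suc k) \<in> x ` {..j}"
      by (cases "j < k") auto
    then show False
      using that by (auto simp: New_def)
  qed
  have finx: "finite (range x)"
  proof -
    have "range x = src ` range e" by (auto simp: x_def)
    then show ?thesis using fin by simp
  qed
  have cardT: "card (range x) \<le> card T + 1"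
  proof -
    have "range x \<subseteq> insert (x 0) (tgt ` T)"
    proof
      fix v assume "v \<in> range x"
      then have ex: "\<exists>k. x k = v" by auto
      \<comment> \<open>The first visit to \<open>v\<close> is at time 0 or comes from a step in
        \<open>New\<close>. The start vertex, which no edge discovers, accounts for the
        \<open>+ 1\<close>.\<close>
      define k where "k = (LEAST k. x k = v)"
      have k: "x k = v" unfolding k_def using ex by (rule LeastI_ex)
      have least: "x j \<noteq> v" if "j < k" for j
        using that not_less_Least unfolding k_def by blast
      show "v \<in> insert (x 0) (tgt ` T)"
      proof (cases k)
        case 0
        then show ?thesis using k by simp
      next
        case (Suc j)
        then have "x (Suc j) \<noteq> x i" if "i \<le> j" for i
          using k least[of i] that by simp
        then have "j \<in> New" by (auto simp: New_def)
        then have "tgt (e j) \<in> tgt ` T" by (simp add: T_def)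
        then show ?thesis using k Suc tgt by simp
      qed
    qed
    moreover have fT: "finite T"
      using fin by (rule rev_finite_subset) (auto simp: T_def)
    ultimately have "card (range x) \<le> card (insert (x 0) (tgt ` T))"
      by (intro card_mono) auto
    also have "\<dots> \<le> card (tgt ` T) + 1"
      using fT by (simp add: card_insert_if)
    also have "\<dots> \<le> card T + 1"
      using fT by (simp add: card_image_le)
    finally show ?thesis .
  qed
  have "inj_on (\<lambda>k. x (Suc k)) New"
    using inj_x by (auto simp: inj_on_def)
  \<comment> \<open>Finiteness makes the number of later discoveries usable as an induction
    measure.\<close>
  then have finNew: "finite New"
    by (rule inj_on_finite[OF _ _ finx]) auto
  have off: "\<mu> a \<in> S" if "a \<in> range e" "a \<notin> T" for a
    unfolding S_def using that by (auto intro: rat_real.span_base)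
  \<comment> \<open>Leaf by leaf, in the reverse order of discovery: every other tree edge at the vertex
      discovered at step \<open>k\<close> was added to the tree later.\<close>
  have tree: "\<mu> (e k) \<in> S" if "k \<in> New" for k
    using that
  proof (induction "card {j\<in>New. k < j}" arbitrary: k rule: less_induct)
    case less
    let ?v = "x (Suc k)"
    let ?In = "{a. a \<in> range e \<and> tgt a = ?v}" and ?Out = "{a. a \<in> range e \<and> src a = ?v}"
    have later: "\<mu> (e j) \<in> S" if "j \<in> New" "k < j" for j
    proof -
      have "{i\<in>New. j < i} \<subset> {i\<in>New. k < i}"
        using that by auto
      then have "card {i\<in>New. j < i} < card {i\<in>New. k < i}"
        using finNew by (intro psubset_card_mono) auto
      then show ?thesis using less that by blast
    qed
    \<comment> \<open>The walk first reaches \<open>?v\<close> at time \<open>k + 1\<close>, so a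
      step leaving \<open>?v\<close> has index greater than \<open>k\<close>.\<close>
    have out: "\<mu> a \<in> S" if "a \<in> ?Out" for a
    proof (cases "a \<in> T")
      case True
      then obtain j where j: "j \<in> New" "a = e j" by (auto simp: T_def)
      then have "x j = ?v" using that by (simp add: x_def)
      then have "x j \<notin> x ` {..k}" using less.prems by (simp add: New_def)
      then have "k < j" by (meson atMost_iff imageI not_less)
      then show ?thesis using later j by simp
    qed (use that off in auto)
    \<comment> \<open>A vertex is discovered only once, so \<open>e k\<close> is the only tree edge
      entering \<open>?v\<close>.\<close>
    have inn: "\<mu> a \<in> S" if "a \<in> ?In - {e k}" for a
    proof (cases "a \<in> T")
      case True
      then obtain j where j: "j \<in> New" "a = e j" by (auto simp: T_def)
      then have "x (Suc j) = ?v" using that tgt by simp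
      then have "j = k" using inj_x j less.prems by blast
      then show ?thesis using that j by simp
    qed (use that off in auto)
    have "\<mu> (e k) + (\<Sum>a\<in>?In - {e k}. \<mu> a) = (\<Sum>a\<in>?In. \<mu> a)"
      using fin tgt by (subst sum.remove[of ?In "e k"]) auto
    then have "\<mu> (e k) = (\<Sum>a\<in>?Out. \<mu> a) - (\<Sum>a\<in>?In - {e k}. \<mu> a)"
      using flow[of ?v] by linarith
    also have "\<dots> \<in> S"
      using out inn unfolding S_def
      by (intro rat_real.span_diff rat_real.span_sum) auto
    finally show ?case .
  qed
  have "\<mu> ` range e \<subseteq> S"
    using off tree by (force simp: T_def)
  moreover have "card (\<mu> ` (range e - T)) + card (range x) \<le> card (range e) + 1"
  proof -
    have "T \<subseteq> range e" by (auto simp: T_def)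
    then have "card (range e - T) + card T = card (range e)"
      using fin by (metis card_Diff_subset card_mono finite_subset le_add_diff_inverse2)
    moreover have "card (\<mu> ` (range e - T)) \<le> card (range e - T)"
      using fin by (intro card_image_le) auto
    ultimately show ?thesis using cardT by linarith
  qed
  moreover have "range (src \<circ> e) = range x"
    by (auto simp: x_def)
  ultimately show ?thesis
    unfolding S_def using fin by (intro exI[of _ "\<mu> ` (range e - T)"]) auto
qed

text \<open>Letter frequencies are finite sums of edge frequencies, so their limits lie in the
  rational span of the limiting flow, which has at most \<open>card B\<close> generators.\<close>

lemma freq_limit_dim_le:
  fixes e :: "nat \<Rightarrow> 'e" and src tgt :: "'e \<Rightarrow> 'v" and h :: "'e \<Rightarrow> 'a"
  assumes fin: "finite (range e)"
    and walk: "\<And>k. tgt (e k) = src (e (Suc k))"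
    and r: "strict_mono (r :: nat \<Rightarrow> nat)"
    and lim: "\<And>i. i \<in> I \<Longrightarrow> (\<lambda>l. freq (\<lambda>k. h (e k)) (r l) i) \<longlonglongrightarrow> f i"
  shows "rat_real.dim (f ` I) + card (range (src \<circ> e)) \<le> card (range e) + 1"
proof -
  \<comment> \<open>Refining \<open>r\<close> makes all edge frequencies converge and leaves the
    letter limits \<open>f\<close> unchanged.\<close>
  obtain s \<mu> where s: "strict_mono (s :: nat \<Rightarrow> nat)"
      "\<And>a. a \<in> range e \<Longrightarrow> (\<lambda>l. freq e (r (s l)) a) \<longlonglongrightarrow> \<mu> a"
    using convergent_subseq_family[OF fin, of "\<lambda>l. freq e (r l)"]
    by (auto simp: freq_bounds)
  define q where "q = r \<circ> s"
  have q: "strict_mono q" "\<And>a. a \<in> range e \<Longrightarrow> (\<lambda>l. freq e (q l) a) \<longlonglongrightarrow> \<mu> a"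
    using r s by (auto simp: q_def strict_mono_def)
  have comp: "(\<lambda>l. freq (\<lambda>k. g (e k)) (q l) b) \<longlonglongrightarrow> (\<Sum>a | a \<in> range e \<and> g a = b. \<mu> a)"
    for g :: "'e \<Rightarrow> 'b" and b
    unfolding freq_comp[OF fin] using q(2) by (intro tendsto_sum) auto
  have flow: "(\<Sum>a | a \<in> range e \<and> tgt a = v. \<mu> a) = (\<Sum>a | a \<in> range e \<and> src a = v. \<mu> a)" for v
  proof -
    \<comment> \<open>By \<open>walk\<close>, the target sequence is the source sequence shifted by
      one, so the imbalance at \<open>v\<close> is at most \<open>1 / q l\<close>.\<close>
    let ?D = "\<lambda>l. freq (\<lambda>k. tgt (e k)) (q l) v - freq (\<lambda>k. src (e k)) (q l) v"
    have "(\<lambda>l. 1 / real (q l)) \<longlonglongrightarrow> 0"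
      using LIMSEQ_subseq_LIMSEQ[OF lim_1_over_n q(1)] by (simp add: o_def)
    then have "?D \<longlonglongrightarrow> 0"
    proof (rule tendsto_0_le[where K = 1], intro always_eventually allI)
      show "norm (?D l) \<le> norm (1 / real (q l)) * 1" for l
        using freq_Suc_diff[of "\<lambda>k. src (e k)" "q l" v] by (simp add: walk)
    qed
    moreover have "?D \<longlonglongrightarrow>
        (\<Sum>a | a \<in> range e \<and> tgt a = v. \<mu> a) - (\<Sum>a | a \<in> range e \<and> src a = v. \<mu> a)"
      by (intro tendsto_diff comp)
    ultimately show ?thesis
      using LIMSEQ_unique by fastforce
  qed
  obtain B where B: "finite B" "card B + card (range (src \<circ> e)) \<le> card (range e) + 1"
      "\<mu> ` range e \<subseteq> rat_real.span B"
    using flow_in_span_off_tree[OF fin walk flow] by blast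
  have "f i \<in> rat_real.span B" if "i \<in> I" for i
  proof -
    have "(\<lambda>l. freq (\<lambda>k. h (e k)) (q l) i) \<longlonglongrightarrow> f i"
      using LIMSEQ_subseq_LIMSEQ[OF lim[OF that] s(1)] by (simp add: o_def q_def)
    then have "f i = (\<Sum>a | a \<in> range e \<and> h a = i. \<mu> a)"
      by (rule LIMSEQ_unique[OF _ comp])
    also have "\<dots> \<in> rat_real.span B"
      using B(3) by (intro rat_real.span_sum) auto
    finally show ?thesis .
  qed
  then have "rat_real.dim (f ` I) \<le> card B"
    using B(1) by (intro rat_real.dim_le_card) auto
  then show ?thesis using B(2) by linarith
qed

section \<open>Factors as edges of the Rauzy graph\<close>

lemma count_pref: "count_list (pref n w) i = card {k. k < n \<and> w k = i}"
proof (induction n)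
  case (Suc n)
  have "{k. k < Suc n \<and> w k = i} =
      (if w n = i then insert n {k. k < n \<and> w k = i} else {k. k < n \<and> w k = i})"
    by (auto simp: less_Suc_eq)
  then show ?case using Suc by (simp add: pref_def)
qed (simp add: pref_def)

lemma factors_range: "factors w n = range (\<lambda>i. map w [i..<i + n])"
  by (auto simp: factors_def)

lemma finite_factors:
  assumes "finite (range w)"
  shows "finite (factors w n)"
proof (rule finite_subset)
  show "factors w n \<subseteq> {xs. set xs \<subseteq> range w \<and> length xs = n}"
    by (auto simp: factors_def)
qed (fact finite_lists_length_eq[OF assms])

lemma complexity_1: "complexity w 1 = card (range w)"
proof -
  have "factors w 1 = (\<lambda>a. [a]) ` range w"
    by (auto simp: factors_def)
  then show ?thesis
    by (simp add: complexity_def card_image inj_on_def)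
qed

lemma complexity_step:
  assumes "finite (range w)" "f \<in> freq_limits d w"
  shows "rat_real.dim (f ` {1..d}) + complexity w n \<le> complexity w (Suc n) + 1"
proof -
  \<comment> \<open>Dropping the last or the first letter of an edge gives its source or target.
    Edges are nonempty, so \<open>hd\<close> reads off a letter even when
    \<open>n = 0\<close>.\<close>
  define e where "e i = map w [i..<i + Suc n]" for i
  have hd_e: "hd (e i) = w i" for i
    by (simp add: e_def upt_rec del: upt_Suc)
  have src: "butlast (e i) = map w [i..<i + n]" for i
    by (simp add: e_def butlast_append)
  have tgt: "tl (e i) = map w [Suc i..<Suc i + n]" for i
  proof -
    have "[i..<i + Suc n] = i # [Suc i..<Suc i + n]"
      by (subst upt_rec) (simp del: upt_Suc)
    then show ?thesis by (simp add: e_def del: upt_Suc)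
  qed
  have range_e: "range e = factors w (Suc n)"
    unfolding factors_range e_def[abs_def] ..
  obtain r :: "nat \<Rightarrow> nat" where r: "strict_mono r"
      "\<And>i. i \<in> {1..d} \<Longrightarrow> (\<lambda>l. freq w (r l) i) \<longlonglongrightarrow> f i"
    using assms(2) by (auto simp: freq_limits_def freq_def count_pref)
  have "rat_real.dim (f ` {1..d}) + card (range (butlast \<circ> e)) \<le> card (range e) + 1"
  proof (rule freq_limit_dim_le)
    show "finite (range e)"
      using assms(1) by (simp add: range_e finite_factors)
    show "tl (e k) = butlast (e (Suc k))" for k
      by (simp add: src tgt)
    show "(\<lambda>l. freq (\<lambda>k. hd (e k)) (r l) i) \<longlonglongrightarrow> f i" if "i \<in> {1..d}" for i
      using r(2)[OF that] by (simp add: hd_e)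
  qed (fact r(1))
  moreover have "range (butlast \<circ> e) = factors w n"
    by (simp add: factors_range o_def src)
  ultimately show ?thesis
    by (simp add: complexity_def range_e)
qed

lemma freq_limits_nonempty: "freq_limits d w \<noteq> {}"
proof -
  \<comment> \<open>The \<open>Suc\<close> keeps the prefix lengths positive, as
    \<open>freq_limits\<close> demands.\<close>
  have "\<exists>s m. strict_mono (s :: nat \<Rightarrow> nat)
      \<and> (\<forall>a\<in>{1..d}. (\<lambda>l. freq w (Suc (s l)) a) \<longlonglongrightarrow> m a \<and> m a \<in> {0..1})"
    by (rule convergent_subseq_family) (auto simp: freq_bounds)
  then obtain s m where s: "strict_mono (s :: nat \<Rightarrow> nat)"
      "\<forall>a\<in>{1..d}. (\<lambda>l. freq w (Suc (s l)) a) \<longlonglongrightarrow> m a \<and> m a \<in> {0..1}"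
    by blast
  \<comment> \<open>\<open>restrict\<close> supplies the value \<open>undefined\<close> outside
    \<open>{1..d}\<close> required by the extensional function space.\<close>
  have "restrict m {1..d} \<in> freq_limits d w"
    unfolding freq_limits_def
    using s by (auto simp: strict_mono_def count_pref freq_def
        intro!: exI[of _ "\<lambda>l. Suc (s l)"])
  then show ?thesis by blast
qed

text \<open>\<open>Max\<close> is only meaningful on finite nonempty sets, hence the compactness argument above.\<close>

lemma max_irrationality_attained:
  obtains f where "f \<in> freq_limits d w" "max_irrationality d w = rat_real.dim (f ` {1..d})"
proof -
  let ?M = "{rat_real.dim (rat_real.span (f ` {1..d})) | f. f \<in> freq_limits d w}"
  have "rat_real.dim (rat_real.span (f ` {1..d})) \<le> d" for f
  proof -
    have "rat_real.dim (f ` {1..d}) \<le> card (f ` {1..d})"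
      by (rule rat_real.dim_le_card') simp
    also have "\<dots> \<le> card {1..d}"
      by (rule card_image_le) simp
    finally show ?thesis by simp
  qed
  then have "finite ?M"
    by (intro finite_subset[of ?M "{..d}"]) auto
  moreover have "?M \<noteq> {}"
    using freq_limits_nonempty by blast
  ultimately have "max_irrationality d w \<in> ?M"
    unfolding max_irrationality_def by (rule Max_in)
  then show ?thesis
    using that by auto
qed

theorem theorem3p1:
  fixes d n :: nat and w :: "nat \<Rightarrow> nat"
  assumes "d \<ge> 1" and "d_ary_word d w" and "n \<ge> 1"
  shows "int (complexity w n) \<ge> (int (max_irrationality d w) - 1) * (int n - 1) + int d"
proof -
  have range_w: "range w = {1..d}"
    using assms(2) by (simp add: d_ary_word_def)
  obtain f where f: "f \<in> freq_limits d w" "max_irrationality d w = rat_real.dim (f ` {1..d})"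
    by (rule max_irrationality_attained)
  \<comment> \<open>One maximising \<open>f\<close> serves all lengths, so the bound telescopes from
    \<open>n = 1\<close>, where the complexity is \<open>d\<close>. Working in \<open>int\<close>
    avoids truncated subtraction.\<close>
  have increment: "int (max_irrationality d w) - 1 + int (complexity w n) \<le> int (complexity w (Suc n))"
    for n
    using complexity_step[OF _ f(1), of n] range_w f(2) by simp
  show ?thesis
    using assms(3)
  proof (induction n rule: dec_induct)
    case base
    show ?case using range_w by (simp add: complexity_1 del: One_nat_def)
  next
    case (step n)
    then show ?case
      using increment[of n]
      by (simp add: algebra_simps)
  qed
qed

end
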